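(* Consider a linear system $\dot x=Ax+Bu$, $y=Cx$ with $A\in\mathbb{R}^{n\times n}$, $B\in\mathbb{R}^{n\times m}$, $C\in\mathbb{R}^{p\times n}$, $p<n$, and $C$ of full row rank. Assume that $\mathcal N\cap\ker B^\top\subseteq\mathrm{Im}\,C^\top$ and that the system has only one uncontrollable eigenvalue $\bar\lambda$ among the distinct eigenvalues $\lambda_1,\dots,\lambda_r$ of $A$. Then the system is output controllable if and only if $$\mathrm{rank}\; C\,[\bar\lambda I-A\ \ B]=p.$$
   Context: Output controllable means that $C[B\ AB\ \cdots\ A^{n-1}B]$ has full row rank $p$. An eigenvalue $\lambda$ of $A$ is uncontrollable if $\mathrm{rank}[\lambda I-A\ \ B]<n$. Eigenvalues may be complex; kernels, images and spans are then understood as subspaces of $\mathbb{C}^n$. $\mathcal N$ denotes the span of the (ordinary) eigenvectors of $A^\top$ that correspond to non-trivial Jordan chains, i.e. to Jordan chains of $A^\top$ of length at least $2$ (so $\mathcal N=\{0\}$ if $A$ is diagonalizable). *)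

theory Defs
  imports
    Complex_Main
    "Jordan_Normal_Form.DL_Rank"
    "Jordan_Normal_Form.Matrix_Kernel"
    "Jordan_Normal_Form.Char_Poly"
begin

definition append_cols :: "'a :: zero mat \<Rightarrow> 'a mat \<Rightarrow> 'a mat" where
  "append_cols M N = four_block_mat M N (0\<^sub>m 0 (dim_col M)) (0\<^sub>m 0 (dim_col N))"

text \<open>
  The block matrix \<open>[B, A B, \<dots>, A^(n-1) B]\<close>: with \<open>m\<close> the number of columns of \<open>B\<close>,
  column \<open>j\<close> is column \<open>j mod m\<close> of the block with index \<open>j div m\<close>.
\<close>

definition controllability_mat :: "'a :: semiring_1 mat \<Rightarrow> 'a mat \<Rightarrow> 'a mat" where
  "controllability_mat A B =
     mat (dim_row A) (dim_row A * dim_col B)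
       (\<lambda>(i, j). (A ^\<^sub>m (j div dim_col B) * B) $$ (i, j mod dim_col B))"

definition output_controllable :: "real mat \<Rightarrow> real mat \<Rightarrow> real mat \<Rightarrow> bool" where
  "output_controllable A B C \<longleftrightarrow>
     vec_space.rank (dim_row C) (C * controllability_mat A B) = dim_row C"

definition pencil_mat :: "'a :: field mat \<Rightarrow> 'a mat \<Rightarrow> 'a \<Rightarrow> 'a mat" where
  "pencil_mat A B l = append_cols (l \<cdot>\<^sub>m 1\<^sub>m (dim_row A) - A) B"

definition uncontrollable_eigenvalue :: "'a :: field mat \<Rightarrow> 'a mat \<Rightarrow> 'a \<Rightarrow> bool" where
  "uncontrollable_eigenvalue A B l \<longleftrightarrow>
     eigenvalue A l \<and> vec_space.rank (dim_row A) (pencil_mat A B l) < dim_row A"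

definition mat_image :: "'a :: semiring_0 mat \<Rightarrow> 'a vec set" where
  "mat_image M = (\<lambda>x. M *\<^sub>v x) ` carrier_vec (dim_col M)"

text \<open>
  A Jordan chain starts with an ordinary eigenvector, followed by generalized eigenvectors
  of increasing rank.
\<close>

definition jordan_chain :: "'a :: field mat \<Rightarrow> 'a \<Rightarrow> 'a vec list \<Rightarrow> bool" where
  "jordan_chain M l vs \<longleftrightarrow>
     vs \<noteq> [] \<and> set vs \<subseteq> carrier_vec (dim_row M) \<and> eigenvector M (hd vs) l \<and>
     (\<forall>i. Suc i < length vs \<longrightarrow> M *\<^sub>v (vs ! Suc i) = l \<cdot>\<^sub>v (vs ! Suc i) + vs ! i)"

text \<open>
  All Jordan chains are admitted, not only those of one fixed Jordan basis; the span of the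
  leading eigenvectors is the same.
\<close>

definition nontrivial_chain_span :: "'a :: field mat \<Rightarrow> 'a vec set" where
  "nontrivial_chain_span M =
     LinearCombinations.module.span class_ring (module_vec TYPE('a) (dim_row M))
       {hd vs | vs l. jordan_chain M l vs \<and> 2 \<le> length vs}"

end

theory Submission
  imports Defs "Jordan_Normal_Form.Schur_Decomposition"
begin

text \<open>
  Write \<open>M = A\<^sup>T\<close>, \<open>N = B\<^sup>T\<close> and let \<open>W\<close> be the space of all \<open>z\<close> with \<open>N M\<^sup>k z = 0\<close> for \<open>k < n\<close>.
  Since a matrix has full row rank iff its transpose has trivial kernel, output controllability
  says that \<open>Im C\<^sup>T\<close> meets \<open>W\<close> trivially, and the rank condition says that it meets
  \<open>E = ker (\<lambda> - M) \<inter> ker N\<close> trivially, where \<open>E \<subseteq> W\<close>. The space \<open>W\<close> is \<open>M\<close>-invariant and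
  contained in \<open>ker N\<close>, so every eigenvector of \<open>M\<close> in \<open>W\<close> belongs to an uncontrollable
  eigenvalue; hence \<open>W\<close> lies in the generalized eigenspace of \<open>\<lambda>\<close>. If some \<open>z \<in> W\<close> were not in
  \<open>E\<close>, the iterates \<open>(M - \<lambda>)\<^sup>k z\<close> would end in a nontrivial Jordan chain inside \<open>W\<close>, whose leading
  eigenvector lies in \<open>Im C\<^sup>T\<close> by hypothesis and in \<open>E\<close>, contradicting the rank condition.
\<close>

section \<open>Full row rank and the kernel of the transpose\<close>

lemma (in vec_space) rank_le_dim:
  assumes X: "X \<in> carrier_mat n nc"
  shows "rank X \<le> n"
proof -
  obtain S where S: "maximal S (\<lambda>T. T \<subseteq> set (cols X) \<and> lin_indpt T)"
    using maximal_exists_superset[of "set (cols X)" "\<lambda>T. T \<subseteq> set (cols X) \<and> lin_indpt T" "{}"]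
    by (auto simp: finite_lin_indpt2)
  then have "S \<subseteq> set (cols X)" "lin_indpt S"
    by (auto simp: maximal_def)
  then have "card S \<le> n"
    using li_le_dim(2)[OF fin_dim] cols_dim[of X] X dim_is_n by auto
  then show ?thesis using rank_card_indpt[OF X S] by simp
qed

lemma mult_transpose_zero_iff:
  assumes "X \<in> carrier_mat p q"
  shows "X\<^sup>T *\<^sub>v y = 0\<^sub>v q \<longleftrightarrow> (\<forall>j<q. col X j \<bullet> y = 0)"
  using assms by (auto simp: vec_eq_iff)

text \<open>The kernel of the transpose is the orthogonal complement, for the bilinear product, of a
  maximal independent set \<open>S\<close> of columns, and \<open>S\<close> has
  \<open>rank X\<close> elements. This complement is trivial exactly when \<open>S\<close> has
  \<open>n\<close> elements, which determinants of square matrices decide.\<close>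

lemma (in vec_space) rank_eq_dim_iff:
  assumes X: "X \<in> carrier_mat n nc"
  shows "rank X = n \<longleftrightarrow> (\<forall>y\<in>carrier_vec n. X\<^sup>T *\<^sub>v y = 0\<^sub>v nc \<longrightarrow> y = 0\<^sub>v n)"
proof -
  obtain S where S: "maximal S (\<lambda>T. T \<subseteq> set (cols X) \<and> lin_indpt T)"
    using maximal_exists_superset[of "set (cols X)" "\<lambda>T. T \<subseteq> set (cols X) \<and> lin_indpt T" "{}"]
    by (auto simp: finite_lin_indpt2)
  then have sub: "S \<subseteq> set (cols X)" and ind: "lin_indpt S"
    by (auto simp: maximal_def)
  have Sc: "S \<subseteq> carrier_vec n" and "finite S"
    using sub cols_dim[of X] X finite_subset by auto
  then obtain ss where ss: "set ss = S" "distinct ss"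
    using finite_distinct_list by blast
  have len: "length ss = rank X"
    using rank_card_indpt[OF X S] ss distinct_card by force
  have kernel: "X\<^sup>T *\<^sub>v y = 0\<^sub>v nc \<longleftrightarrow> (\<forall>s\<in>S. s \<bullet> y = 0)" if y: "y \<in> carrier_vec n" for y
  proof
    assume "X\<^sup>T *\<^sub>v y = 0\<^sub>v nc"
    then show "\<forall>s\<in>S. s \<bullet> y = 0"
      using sub X by (auto simp: mult_transpose_zero_iff[OF X] cols_def)
  next
    assume orth: "\<forall>s\<in>S. s \<bullet> y = 0"
    have "submodule class_ring {v \<in> carrier_vec n. v \<bullet> y = 0} V"
      using y by (auto simp: submodule_def add_scalar_prod_distrib[of _ n] module_axioms
          smult_scalar_prod_distrib[of _ n] class_ring_simps module_vec_simps)
    then have span: "span S \<subseteq> {v \<in> carrier_vec n. v \<bullet> y = 0}"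
      using orth Sc by (intro span_is_subset) auto
    \<comment> \<open>By maximality, adjoining any further column to \<open>S\<close> creates a
      dependence.\<close>
    have "c \<in> span S" if c: "c \<in> set (cols X)" for c
    proof (cases "c \<in> S")
      case True
      then show ?thesis using in_own_span Sc by auto
    next
      case False
      have "lin_dep (S \<union> {c})"
        using S False c unfolding maximal_def by blast
      moreover have "c \<in> carrier_vec n" using c cols_dim[of X] X by auto
      ultimately show ?thesis using lin_dep_iff_in_span[of S c] Sc ind False by auto
    qed
    then have "c \<bullet> y = 0" if "c \<in> set (cols X)" for c
      using span that by blast
    then show "X\<^sup>T *\<^sub>v y = 0\<^sub>v nc"
      using X by (auto simp: mult_transpose_zero_iff[OF X] cols_def)
  qed
  show ?thesis
  proof
    assume r: "rank X = n"
    define Q where "Q = mat_of_cols n ss"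
    have Q: "Q \<in> carrier_mat n n" and cols: "cols Q = ss"
      using len r ss Sc by (auto simp: Q_def)
    have "rank Q = n" using lin_indpt_full_rank[OF Q] cols ss ind by simp
    then have "det Q\<^sup>T \<noteq> 0" using det_rank_iff[OF Q] det_transpose[OF Q] by simp
    then have inj: "Q\<^sup>T *\<^sub>v y = 0\<^sub>v n \<Longrightarrow> y = 0\<^sub>v n" if "y \<in> carrier_vec n" for y
      using det_0_iff_vec_prod_zero_field[of "Q\<^sup>T" n] Q that by auto
    have "col Q j \<in> S" if "j < n" for j
      using cols ss that Q by (metis carrier_matD(2) cols_length cols_nth nth_mem)
    then show "\<forall>y\<in>carrier_vec n. X\<^sup>T *\<^sub>v y = 0\<^sub>v nc \<longrightarrow> y = 0\<^sub>v n"
      using kernel inj mult_transpose_zero_iff[OF Q] by auto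
  next
    assume triv: "\<forall>y\<in>carrier_vec n. X\<^sup>T *\<^sub>v y = 0\<^sub>v nc \<longrightarrow> y = 0\<^sub>v n"
    show "rank X = n"
    proof (rule ccontr)
      assume "rank X \<noteq> n"
      then have lt: "length ss < n" using rank_le_dim[OF X] len by simp
      \<comment> \<open>Padding with zero rows gives a square matrix. Its last row is zero because
        \<open>length ss < n\<close>, so the last unit vector lies in the kernel of the transpose
        and the determinant vanishes.\<close>
      define R where "R = mat_of_rows n (ss @ replicate (n - length ss) (0\<^sub>v n))"
      have R: "R \<in> carrier_mat n n" using lt by (auto simp: R_def)
      have row_R: "row R i = (if i < length ss then ss ! i else 0\<^sub>v n)" if "i < n" for i
      proof -
        have "row R i = (ss @ replicate (n - length ss) (0\<^sub>v n)) ! i"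
          unfolding R_def using that Sc ss nth_mem[of i ss] lt
          by (intro mat_of_rows_row) (auto simp: nth_append)
        then show ?thesis using that by (simp add: nth_append)
      qed
      have "R\<^sup>T *\<^sub>v unit_vec n (n - 1) = 0\<^sub>v n"
        using R lt row_R[of "n - 1"] by (auto intro!: eq_vecI) (auto simp: row_def vec_eq_iff)
      moreover have "unit_vec n (n - 1) \<noteq> 0\<^sub>v n"
        using lt by (intro unit_vec_nonzero) simp
      ultimately have "det R\<^sup>T = 0"
        using det_0_iff_vec_prod_zero_field[of "R\<^sup>T" n] R by (meson transpose_carrier_mat unit_vec_carrier)
      then obtain y where y: "y \<in> carrier_vec n" "y \<noteq> 0\<^sub>v n" "R *\<^sub>v y = 0\<^sub>v n"
        using det_0_iff_vec_prod_zero_field[OF R] det_transpose[OF R] by auto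
      have "s \<bullet> y = 0" if "s \<in> S" for s
      proof -
        obtain i where i: "i < length ss" "s = ss ! i" using \<open>s \<in> S\<close> ss by (metis in_set_conv_nth)
        have "(R *\<^sub>v y) $ i = row R i \<bullet> y" using i lt R by simp
        then show ?thesis using i lt y row_R[of i] by simp
      qed
      then show False using kernel y triv by blast
    qed
  qed
qed

section \<open>Annihilating products of shifts\<close>

text \<open>This is the product of the matrices M - a, for a in the list, applied to
  \<open>v\<close> with the head acting first. Working on vectors allows inductions on the list that
  generalise over \<open>v\<close>.\<close>

primrec shift_prod :: "'a :: comm_ring_1 mat \<Rightarrow> 'a list \<Rightarrow> 'a vec \<Rightarrow> 'a vec" where
  "shift_prod M [] v = v"
| "shift_prod M (a # as) v = shift_prod M as (M *\<^sub>v v - a \<cdot>\<^sub>v v)"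

text \<open>The shift by the diagonal entry of index \<open>j\<close> maps the span of the first
  \<open>j + 1\<close> unit vectors into the span of the first \<open>j\<close>. The list is
  reversed because the last diagonal entry must act first.\<close>

lemma shift_prod_upper_triangular:
  assumes T: "T \<in> carrier_mat n n" and ut: "upper_triangular T"
    and "j \<le> n" and "v \<in> carrier_vec n" and "\<And>i. j \<le> i \<Longrightarrow> i < n \<Longrightarrow> v $ i = 0"
  shows "shift_prod T (map (\<lambda>i. T $$ (i, i)) (rev [0..<j])) v = 0\<^sub>v n"
  using assms(3-)
proof (induction j arbitrary: v)
  case 0
  then show ?case by (auto simp: vec_eq_iff)
next
  case (Suc j)
  have "(T *\<^sub>v v - T $$ (j, j) \<cdot>\<^sub>v v) $ i = 0" if i: "j \<le> i" "i < n" for i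
  proof -
    have "(T *\<^sub>v v) $ i = (\<Sum>k = 0..<n. T $$ (i, k) * v $ k)"
      using T Suc.prems i by (simp add: scalar_prod_def)
    \<comment> \<open>Terms with \<open>k < j\<close> vanish by triangularity, those with
      \<open>k > j\<close> because \<open>v\<close> vanishes there.\<close>
    also have "\<dots> = (\<Sum>k = 0..<n. if k = j then T $$ (i, j) * v $ j else 0)"
    proof (rule sum.cong)
      fix k assume k: "k \<in> {0..<n}"
      have "T $$ (i, k) = 0" if "k < j"
        using ut T i that by (auto simp: upper_triangular_def)
      then show "T $$ (i, k) * v $ k = (if k = j then T $$ (i, j) * v $ j else 0)"
        using Suc.prems(3)[of k] k by (cases k j rule: linorder_cases) auto
    qed simp
    also have "\<dots> = T $$ (i, j) * v $ j" using Suc.prems by simp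
    \<comment> \<open>For \<open>i > j\<close> both sides are zero: on the left \<open>T\<close>
      vanishes below the diagonal, on the right \<open>v $ i = 0\<close>.\<close>
    also have "\<dots> = T $$ (j, j) * v $ i"
      using T ut Suc.prems i by (cases "i = j") (auto simp: upper_triangular_def)
    finally show ?thesis using T Suc.prems i by simp
  qed
  then show ?case using Suc.IH[of "T *\<^sub>v v - T $$ (j, j) \<cdot>\<^sub>v v"] Suc.prems T by simp
qed

text \<open>Since PTQP = PT, the matrix \<open>P\<close> intertwines the shifts of \<open>T\<close>
  with those of PTQ.\<close>

lemma shift_prod_similar:
  fixes T :: "'a :: field mat"
  assumes P: "P \<in> carrier_mat n n" and Q: "Q \<in> carrier_mat n n" and T: "T \<in> carrier_mat n n"
    and QP: "Q * P = 1\<^sub>m n" and v: "v \<in> carrier_vec n"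
  shows "shift_prod (P * T * Q) as (P *\<^sub>v v) = P *\<^sub>v shift_prod T as v"
  using v
proof (induction as arbitrary: v)
  case (Cons a as)
  have "Q *\<^sub>v (P *\<^sub>v v) = v"
    using assoc_mult_mat_vec[OF Q P Cons.prems] QP Cons.prems by simp
  then have "P * T * Q *\<^sub>v (P *\<^sub>v v) = P *\<^sub>v (T *\<^sub>v v)"
    using assoc_mult_mat_vec[OF mult_carrier_mat[OF P T] Q, of "P *\<^sub>v v"]
      assoc_mult_mat_vec[OF P T Cons.prems] P Cons.prems by simp
  then have "P * T * Q *\<^sub>v (P *\<^sub>v v) - a \<cdot>\<^sub>v (P *\<^sub>v v) = P *\<^sub>v (T *\<^sub>v v - a \<cdot>\<^sub>v v)"
    using mult_minus_distrib_mat_vec[OF P, of "T *\<^sub>v v" "a \<cdot>\<^sub>v v"]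
      mult_mat_vec[OF P Cons.prems] T Cons.prems by simp
  then show ?case using Cons T by simp
qed simp

text \<open>A factored form of the Cayley-Hamilton theorem, obtained by Schur triangularization over
  the complex numbers. The length \<open>n\<close> is what later bounds the powers involved.\<close>

lemma shift_prod_annihilates:
  fixes M :: "complex mat"
  assumes M: "M \<in> carrier_mat n n"
  obtains as where "length as = n" "\<And>v. v \<in> carrier_vec n \<Longrightarrow> shift_prod M as v = 0\<^sub>v n"
proof -
  obtain es where "char_poly M = (\<Prod>a\<leftarrow>es. [:- a, 1:])"
    using char_poly_factorized[OF M] by blast
  then obtain T where T: "T \<in> carrier_mat n n" "upper_triangular T" "similar_mat M T"
    using schur_decomposition_exists[OF M] by blast
  obtain P Q where "similar_mat_wit M T P Q" using T(3) by (auto simp: similar_mat_def)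
  note wit = similar_mat_witD2[OF M this]
  let ?as = "map (\<lambda>i. T $$ (i, i)) (rev [0..<n])"
  show thesis
  proof
    show "length ?as = n" by simp
    fix v :: "complex vec" assume v: "v \<in> carrier_vec n"
    have Qv: "Q *\<^sub>v v \<in> carrier_vec n" using wit(7) v by simp
    then have "shift_prod T ?as (Q *\<^sub>v v) = 0\<^sub>v n"
      using shift_prod_upper_triangular[OF T(1,2), of n "Q *\<^sub>v v"] by simp
    moreover have "P *\<^sub>v (Q *\<^sub>v v) = v"
      using assoc_mult_mat_vec[OF wit(6,7) v] wit(1) v by simp
    ultimately have "shift_prod M ?as v = P *\<^sub>v 0\<^sub>v n"
      using shift_prod_similar[OF wit(6,7,5,2) Qv, of ?as, folded wit(3)] by simp
    then show "shift_prod M ?as v = 0\<^sub>v n"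
      using wit(6) by (auto simp: vec_eq_iff)
  qed
qed

lemma shift_prod_carrier [simp]:
  assumes "M \<in> carrier_mat n n" and "v \<in> carrier_vec n"
  shows "shift_prod M as v \<in> carrier_vec n"
  using assms(2) by (induction as arbitrary: v) (use assms(1) in auto)

text \<open>All shifts are polynomials in \<open>M\<close>, hence commute, so a first factor may be
  moved to the end.\<close>

lemma shift_prod_commute:
  fixes M :: "'a :: field mat"
  assumes M: "M \<in> carrier_mat n n" and "v \<in> carrier_vec n"
  shows "shift_prod M as (M *\<^sub>v v - a \<cdot>\<^sub>v v) = M *\<^sub>v shift_prod M as v - a \<cdot>\<^sub>v shift_prod M as v"
  using assms(2)
proof (induction as arbitrary: v)
  case (Cons b as)
  have "M *\<^sub>v (M *\<^sub>v v - a \<cdot>\<^sub>v v) - b \<cdot>\<^sub>v (M *\<^sub>v v - a \<cdot>\<^sub>v v)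
      = M *\<^sub>v (M *\<^sub>v v - b \<cdot>\<^sub>v v) - a \<cdot>\<^sub>v (M *\<^sub>v v - b \<cdot>\<^sub>v v)"
    using M Cons.prems
    by (auto simp: mult_minus_distrib_mat_vec[OF M] mult_mat_vec[OF M] vec_eq_iff algebra_simps)
  then show ?case using Cons M by simp
qed simp

section \<open>The unobservable space and its invariance\<close>

text \<open>For \<open>M\<close> and \<open>N\<close> the transposes of \<open>A\<close> and
  \<open>B\<close>, this is the orthogonal complement of the reachable space. Only powers below the
  dimension occur, matching the controllability matrix, so invariance under \<open>M\<close>
  requires the annihilating product.\<close>

definition unobservable_space :: "'a :: semiring_1 mat \<Rightarrow> 'a mat \<Rightarrow> 'a vec set" where
  "unobservable_space M N =
     {z \<in> carrier_vec (dim_row M). \<forall>k<dim_row M. N *\<^sub>v (M ^\<^sub>m k *\<^sub>v z) = 0\<^sub>v (dim_row N)}"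

lemma pow_Suc_mult_vec:
  assumes "M \<in> carrier_mat n n" and "z \<in> carrier_vec n"
  shows "M ^\<^sub>m Suc k *\<^sub>v z = M ^\<^sub>m k *\<^sub>v (M *\<^sub>v z)"
  using assms assoc_mult_mat_vec[of "M ^\<^sub>m k" n n M n z] by simp

lemma output_diff_smult:
  fixes M :: "'a :: field mat"
  assumes M: "M \<in> carrier_mat n n" and N: "N \<in> carrier_mat m n"
    and "v \<in> carrier_vec n" and "w \<in> carrier_vec n"
  shows "N *\<^sub>v (M ^\<^sub>m k *\<^sub>v (v - a \<cdot>\<^sub>v w)) = N *\<^sub>v (M ^\<^sub>m k *\<^sub>v v) - a \<cdot>\<^sub>v (N *\<^sub>v (M ^\<^sub>m k *\<^sub>v w))"
  using assms pow_carrier_mat[OF M, of k] mult_mat_vec_carrier[OF pow_carrier_mat[OF M, of k]]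
  by (simp add: mult_minus_distrib_mat_vec[of _ n n] mult_mat_vec[of _ n n]
      mult_minus_distrib_mat_vec[of _ m n] mult_mat_vec[of _ m n])

text \<open>The product is monic in \<open>M\<close> of degree \<open>length as\<close>, and
  \<open>N\<close> kills the contribution of every lower power.\<close>

lemma output_shift_prod:
  fixes M :: "'a :: field mat"
  assumes M: "M \<in> carrier_mat n n" and N: "N \<in> carrier_mat m n"
    and "z \<in> carrier_vec n" and "\<And>k. k < length as \<Longrightarrow> N *\<^sub>v (M ^\<^sub>m k *\<^sub>v z) = 0\<^sub>v m"
  shows "N *\<^sub>v shift_prod M as z = N *\<^sub>v (M ^\<^sub>m length as *\<^sub>v z)"
  using assms(3-)
proof (induction as arbitrary: z)
  case Nil
  then show ?case using M by simp
next
  case (Cons a as)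
  \<comment> \<open>The term with \<open>a\<close> vanishes by hypothesis for every \<open>k\<close>
    up to and including \<open>length as\<close>, so a shift acts on these outputs like
    \<open>M\<close>. The last value of \<open>k\<close> is the one in the conclusion of the
    induction hypothesis.\<close>
  have step: "N *\<^sub>v (M ^\<^sub>m k *\<^sub>v (M *\<^sub>v z - a \<cdot>\<^sub>v z))
      = N *\<^sub>v (M ^\<^sub>m Suc k *\<^sub>v z)" if "k < Suc (length as)" for k
    using output_diff_smult[OF M N, of "M *\<^sub>v z" z k a] Cons.prems(2)[of k] that M N Cons.prems(1)
    unfolding pow_Suc_mult_vec[OF M Cons.prems(1)] by (auto simp: vec_eq_iff)
  have "M *\<^sub>v z - a \<cdot>\<^sub>v z \<in> carrier_vec n" using M Cons.prems(1) by simp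
  then show ?case
    using Cons.IH[of "M *\<^sub>v z - a \<cdot>\<^sub>v z"] step Cons.prems(2) by (simp del: pow_mat.simps)
qed

lemma unobservable_space_mult:
  fixes M :: "complex mat"
  assumes M: "M \<in> carrier_mat n n" and N: "N \<in> carrier_mat m n"
    and z: "z \<in> unobservable_space M N"
  shows "M *\<^sub>v z \<in> unobservable_space M N"
proof -
  have zc: "z \<in> carrier_vec n" and zero: "\<And>k. k < n \<Longrightarrow> N *\<^sub>v (M ^\<^sub>m k *\<^sub>v z) = 0\<^sub>v m"
    using z M N by (auto simp: unobservable_space_def)
  \<comment> \<open>Expanding the annihilating product leaves only the top term, since \<open>N M\<^sup>k z = 0\<close> for \<open>k < n\<close>.\<close>
  obtain as where as: "length as = n" "shift_prod M as z = 0\<^sub>v n"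
    using shift_prod_annihilates[OF M] zc by metis
  have "N *\<^sub>v (M ^\<^sub>m n *\<^sub>v z) = N *\<^sub>v 0\<^sub>v n"
    using output_shift_prod[OF M N zc, of as] zero as by simp
  also have "\<dots> = 0\<^sub>v m" using N by (auto simp: vec_eq_iff)
  finally have "N *\<^sub>v (M ^\<^sub>m Suc k *\<^sub>v z) = 0\<^sub>v m" if "k < n" for k
    using zero[of "Suc k"] that by (cases "Suc k = n") (auto simp del: pow_mat.simps)
  then show ?thesis
    using M N zc pow_Suc_mult_vec[OF M zc] by (auto simp: unobservable_space_def)
qed

lemma unobservable_space_shift:
  fixes M :: "complex mat"
  assumes M: "M \<in> carrier_mat n n" and N: "N \<in> carrier_mat m n"
    and z: "z \<in> unobservable_space M N"
  shows "M *\<^sub>v z - a \<cdot>\<^sub>v z \<in> unobservable_space M N"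
proof -
  have zc: "z \<in> carrier_vec n"
    using z M by (auto simp: unobservable_space_def)
  show ?thesis
    using unobservable_space_mult[OF M N z] z M N zc output_diff_smult[OF M N, of "M *\<^sub>v z" z]
    by (auto simp: unobservable_space_def)
qed

lemma unobservable_space_shift_prod:
  fixes M :: "complex mat"
  assumes M: "M \<in> carrier_mat n n" and N: "N \<in> carrier_mat m n"
    and z: "z \<in> unobservable_space M N"
  shows "shift_prod M as z \<in> unobservable_space M N"
  using z by (induction as arbitrary: z) (auto intro: unobservable_space_shift[OF M N])

lemma unobservable_space_kernel:
  assumes M: "M \<in> carrier_mat n n" and N: "N \<in> carrier_mat m n" and "0 < n"
    and z: "z \<in> unobservable_space M N"
  shows "z \<in> carrier_vec n" and "N *\<^sub>v z = 0\<^sub>v m"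
  using z M N \<open>0 < n\<close> by (auto simp: unobservable_space_def dest: spec[of _ 0])

text \<open>Powers of \<open>M\<close> act on an eigenvector as scalars, so \<open>N\<close> kills
  all iterates as soon as it kills the vector.\<close>

lemma eigenvector_in_unobservable_space:
  fixes M :: "'a :: field mat"
  assumes M: "M \<in> carrier_mat n n" and N: "N \<in> carrier_mat m n" and z: "z \<in> carrier_vec n"
    and eig: "M *\<^sub>v z = l \<cdot>\<^sub>v z" and "N *\<^sub>v z = 0\<^sub>v m"
  shows "z \<in> unobservable_space M N"
proof -
  have "M ^\<^sub>m k *\<^sub>v z = l ^ k \<cdot>\<^sub>v z" for k
  proof (induction k)
    case 0
    then show ?case using M z by simp
  next
    case (Suc k)
    then show ?case
      using pow_Suc_mult_vec[OF M z, of k] eig mult_mat_vec[OF pow_carrier_mat[OF M] z, of k l]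
      by (simp del: pow_mat.simps add: smult_smult_assoc mult.commute)
  qed
  then show ?thesis
    using assms by (auto simp: unobservable_space_def mult_mat_vec[OF N z])
qed

section \<open>Nilpotency and Jordan chains in the unobservable space\<close>

text \<open>A factor M - a with a different from \<open>l\<close> is injective on the unobservable
  space, since a nonzero kernel vector would be an eigenvector killed by \<open>N\<close>. Stripping
  such factors from an annihilating product leaves only shifts by \<open>l\<close>.\<close>

lemma unobservable_space_nilpotent:
  fixes M :: "complex mat"
  assumes M: "M \<in> carrier_mat n n" and N: "N \<in> carrier_mat m n" and n: "0 < n"
    and uniq: "\<forall>\<mu> v. eigenvector M v \<mu> \<and> N *\<^sub>v v = 0\<^sub>v m \<longrightarrow> \<mu> = l"
    and z: "z \<in> unobservable_space M N"
  shows "\<exists>k. shift_prod M (replicate k l) z = 0\<^sub>v n"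
proof -
  have "\<exists>k. shift_prod M (replicate k l) z = 0\<^sub>v n" if "shift_prod M as z = 0\<^sub>v n" for as
    using that z
  proof (induction as arbitrary: z)
    case Nil
    then have "shift_prod M (replicate 0 l) z = 0\<^sub>v n" by simp
    then show ?case by blast
  next
    case (Cons a as)
    note zc = unobservable_space_kernel(1)[OF M N n Cons.prems(2)]
    obtain k where k: "shift_prod M (replicate k l) (M *\<^sub>v z - a \<cdot>\<^sub>v z) = 0\<^sub>v n"
      using Cons.IH[OF _ unobservable_space_shift[OF M N Cons.prems(2)]] Cons.prems(1) by auto
    show ?case
    proof (cases "a = l")
      case True
      then have "shift_prod M (replicate (Suc k) l) z = 0\<^sub>v n" using k by simp
      then show ?thesis by blast
    next
      case False
      \<comment> \<open>After commuting the factors, \<open>k\<close> says that M - a kills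
        \<open>u\<close>. As \<open>u\<close> stays in the unobservable space, it must be zero, and
        the same \<open>k\<close> serves for \<open>z\<close>.\<close>
      define u where "u = shift_prod M (replicate k l) z"
      have u: "u \<in> carrier_vec n" "N *\<^sub>v u = 0\<^sub>v m"
        using unobservable_space_kernel[OF M N n]
          unobservable_space_shift_prod[OF M N Cons.prems(2)] by (auto simp: u_def)
      have "M *\<^sub>v u - a \<cdot>\<^sub>v u = 0\<^sub>v n"
        using k shift_prod_commute[OF M zc] by (simp add: u_def)
      then have "M *\<^sub>v u = a \<cdot>\<^sub>v u"
        using M u(1) by (auto simp: vec_eq_iff)
      then have "u = 0\<^sub>v n" using uniq False u M by (auto simp: eigenvector_def)
      then show ?thesis by (auto simp: u_def)
    qed
  qed
  moreover obtain as where "shift_prod M as z = 0\<^sub>v n"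
    using shift_prod_annihilates[OF M] unobservable_space_kernel(1)[OF M N n z] by metis
  ultimately show ?thesis by blast
qed

text \<open>Take the last nonzero iterate of \<open>z\<close> under M - l; it is an eigenvector.
  Either it is \<open>z\<close> itself, or it and the iterate before it form a chain of length
  two.\<close>

lemma unobservable_space_chain:
  fixes M :: "complex mat"
  assumes M: "M \<in> carrier_mat n n" and N: "N \<in> carrier_mat m n" and n: "0 < n"
    and uniq: "\<forall>\<mu> v. eigenvector M v \<mu> \<and> N *\<^sub>v v = 0\<^sub>v m \<longrightarrow> \<mu> = l"
    and z: "z \<in> unobservable_space M N" and nz: "z \<noteq> 0\<^sub>v n"
  obtains "M *\<^sub>v z = l \<cdot>\<^sub>v z"
  | u v where "jordan_chain M l [v, u]" and "N *\<^sub>v v = 0\<^sub>v m"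
proof -
  note zc = unobservable_space_kernel(1)[OF M N n z]
  define w where "w k = shift_prod M (replicate k l) z" for k
  have wU: "w k \<in> unobservable_space M N" for k
    using unobservable_space_shift_prod[OF M N z] by (simp add: w_def)
  note w = unobservable_space_kernel[OF M N n wU]
  have w_Suc: "w (Suc k) = M *\<^sub>v w k - l \<cdot>\<^sub>v w k" for k
    using shift_prod_commute[OF M zc] by (simp add: w_def)
  have w0: "w 0 = z" by (simp add: w_def)
  obtain k0 where "w k0 = 0\<^sub>v n"
    using unobservable_space_nilpotent[OF M N n uniq z] unfolding w_def by blast
  then obtain k where k: "w k \<noteq> 0\<^sub>v n" "w (Suc k) = 0\<^sub>v n"
    using ex_least_nat_less[of "\<lambda>k. w k = 0\<^sub>v n"] nz w0 by blast
  have eig: "M *\<^sub>v w k = l \<cdot>\<^sub>v w k"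
    using k(2) w_Suc[of k] w(1)[of k] M by (auto simp: vec_eq_iff)
  show thesis
  proof (cases k)
    case 0
    then show thesis using eig w0 that(1) by simp
  next
    case (Suc j)
    have "M *\<^sub>v w j = l \<cdot>\<^sub>v w j + w k"
      using w_Suc[of j] w(1)[of j] M Suc by (auto simp: vec_eq_iff)
    then have "jordan_chain M l [w k, w j]"
      using eig k(1) w(1) M by (auto simp: jordan_chain_def eigenvector_def less_Suc_eq)
    then show thesis using that(2) w(2) by blast
  qed
qed

section \<open>Kernels of the transposed pencil and controllability matrices\<close>

lemma col_append_cols:
  assumes "M \<in> carrier_mat n a" and "N \<in> carrier_mat n b" and "j < a + b"
  shows "col (append_cols M N) j = (if j < a then col M j else col N (j - a))"
  using assms by (auto simp: append_cols_def vec_eq_iff)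

lemma pencil_mat_carrier:
  assumes "A \<in> carrier_mat n n" and "B \<in> carrier_mat n m"
  shows "pencil_mat A B l \<in> carrier_mat n (n + m)"
  using assms by (auto simp: pencil_mat_def append_cols_def)

text \<open>The left null vectors of the pencil, as in the Popov-Belevitch-Hautus test, read off
  column by column.\<close>

lemma transpose_pencil_mat_kernel:
  assumes A: "A \<in> carrier_mat n n" and B: "B \<in> carrier_mat n m" and z: "z \<in> carrier_vec n"
  shows "(pencil_mat A B l)\<^sup>T *\<^sub>v z = 0\<^sub>v (n + m) \<longleftrightarrow> A\<^sup>T *\<^sub>v z = l \<cdot>\<^sub>v z \<and> B\<^sup>T *\<^sub>v z = 0\<^sub>v m"
proof -
  define S where "S = l \<cdot>\<^sub>m 1\<^sub>m n - A"
  have S: "S \<in> carrier_mat n n" using minus_carrier_mat[OF A] by (simp add: S_def)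
  have col_S: "col S j \<bullet> z = l * z $ j - col A j \<bullet> z" if "j < n" for j
  proof -
    have "col S j = l \<cdot>\<^sub>v unit_vec n j - col A j"
      using that A by (auto simp: S_def vec_eq_iff)
    then show ?thesis
      using that A z by (simp add: minus_scalar_prod_distrib[of _ n])
  qed
  have "(pencil_mat A B l)\<^sup>T *\<^sub>v z = 0\<^sub>v (n + m)
      \<longleftrightarrow> (\<forall>j<n + m. (if j < n then col S j else col B (j - n)) \<bullet> z = 0)"
    using mult_transpose_zero_iff[OF pencil_mat_carrier[OF A B]] A col_append_cols[OF S B]
    by (simp add: pencil_mat_def S_def)
  also have "\<dots> \<longleftrightarrow> (\<forall>j<n. col S j \<bullet> z = 0) \<and> (\<forall>j<m. col B j \<bullet> z = 0)"
    by (auto simp: all_conj_distrib split: if_splits)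
  also have "(\<forall>j<n. col S j \<bullet> z = 0) \<longleftrightarrow> A\<^sup>T *\<^sub>v z = l \<cdot>\<^sub>v z"
    using A z col_S by (auto simp: vec_eq_iff)
  finally show ?thesis using mult_transpose_zero_iff[OF B] by simp
qed

lemma transpose_pow_mat:
  fixes A :: "'a :: comm_semiring_1 mat"
  assumes A: "A \<in> carrier_mat n n"
  shows "(A ^\<^sub>m k)\<^sup>T = A\<^sup>T ^\<^sub>m k"
proof (induction k)
  case (Suc k)
  \<comment> \<open>Matrix powers append factors on the right, but transposition moves the new
    factor to the left.\<close>
  have "A\<^sup>T * A\<^sup>T ^\<^sub>m k = A\<^sup>T ^\<^sub>m k * A\<^sup>T"
  proof (induction k)
    case (Suc k)
    then show ?case using A by (simp add: assoc_mult_mat[of _ n n _ n _ n, symmetric])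
  qed (use A in simp)
  then show ?case using Suc A by (simp add: transpose_mult[of _ n n _ n])
qed (use A in simp)

lemma controllability_mat_carrier:
  assumes "A \<in> carrier_mat n n" and "B \<in> carrier_mat n m"
  shows "controllability_mat A B \<in> carrier_mat n (n * m)"
  using assms by (simp add: controllability_mat_def)

text \<open>Block \<open>k\<close> of the transpose is
  \<open>B\<^sup>T * A\<^sup>T ^\<^sub>m k\<close>; column \<open>i\<close> of block
  \<open>k\<close> has index \<open>k * m + i\<close>.\<close>

lemma transpose_controllability_mat_kernel:
  fixes A :: "'a :: comm_ring_1 mat"
  assumes A: "A \<in> carrier_mat n n" and B: "B \<in> carrier_mat n m" and z: "z \<in> carrier_vec n"
  shows "(controllability_mat A B)\<^sup>T *\<^sub>v z = 0\<^sub>v (n * m) \<longleftrightarrow> z \<in> unobservable_space A\<^sup>T B\<^sup>T"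
proof -
  have col: "col (controllability_mat A B) j = col (A ^\<^sub>m (j div m) * B) (j mod m)"
    if "j < n * m" for j
  proof -
    have "0 < m" using that by (cases m) auto
    then show ?thesis using that A B by (auto simp: controllability_mat_def vec_eq_iff)
  qed
  have "(controllability_mat A B)\<^sup>T *\<^sub>v z = 0\<^sub>v (n * m)
      \<longleftrightarrow> (\<forall>j<n * m. col (A ^\<^sub>m (j div m) * B) (j mod m) \<bullet> z = 0)"
    using mult_transpose_zero_iff[OF controllability_mat_carrier[OF A B]] col by simp
  also have "\<dots> \<longleftrightarrow> (\<forall>k<n. \<forall>i<m. col (A ^\<^sub>m k * B) i \<bullet> z = 0)"
  proof (intro iffI allI impI)
    fix k i assume *: "\<forall>j<n * m. col (A ^\<^sub>m (j div m) * B) (j mod m) \<bullet> z = 0" "k < n" "i < m"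
    have "k * m + i < Suc k * m" using \<open>i < m\<close> by simp
    also have "\<dots> \<le> n * m" using \<open>k < n\<close> by (intro mult_le_mono1) simp
    finally show "col (A ^\<^sub>m k * B) i \<bullet> z = 0"
      using *(1)[rule_format, of "k * m + i"] \<open>i < m\<close> by simp
  next
    fix j assume *: "\<forall>k<n. \<forall>i<m. col (A ^\<^sub>m k * B) i \<bullet> z = 0" "j < n * m"
    then have "0 < m" by (cases m) auto
    then show "col (A ^\<^sub>m (j div m) * B) (j mod m) \<bullet> z = 0"
      using * by (simp add: less_mult_imp_div_less)
  qed
  also have "\<dots> \<longleftrightarrow> (\<forall>k<n. (A ^\<^sub>m k * B)\<^sup>T *\<^sub>v z = 0\<^sub>v m)"
    by (simp only: mult_transpose_zero_iff[OF mult_carrier_mat[OF pow_carrier_mat[OF A] B]])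
  also have "\<dots> \<longleftrightarrow> (\<forall>k<n. B\<^sup>T *\<^sub>v (A\<^sup>T ^\<^sub>m k *\<^sub>v z) = 0\<^sub>v m)"
  proof -
    have "(A ^\<^sub>m k * B)\<^sup>T *\<^sub>v z = B\<^sup>T *\<^sub>v (A\<^sup>T ^\<^sub>m k *\<^sub>v z)" for k
      using A B z assoc_mult_mat_vec[of "B\<^sup>T" m n "A\<^sup>T ^\<^sub>m k" n z]
      by (simp add: transpose_mult[of _ n n _ m] transpose_pow_mat[OF A])
    then show ?thesis by simp
  qed
  finally show ?thesis using A B z by (simp add: unobservable_space_def)
qed

section \<open>Passage to the complex numbers and rank criteria\<close>

text \<open>The real and imaginary parts of a complex kernel vector of a real matrix are kernel
  vectors, and real kernel vectors embed. This links output controllability, stated over the reals,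
  with a possibly complex \<open>lbar\<close>.\<close>

lemma rank_map_complex_of_real_eq_iff:
  assumes X: "X \<in> carrier_mat p q"
  shows "vec_space.rank p (map_mat complex_of_real X) = p \<longleftrightarrow> vec_space.rank p X = p"
proof -
  let ?X = "map_mat complex_of_real X"
  have cX: "?X \<in> carrier_mat p q" using X by simp
  have Re: "Re (col ?X j \<bullet> y) = col X j \<bullet> map_vec Re y"
    and Im: "Im (col ?X j \<bullet> y) = col X j \<bullet> map_vec Im y"
    if "y \<in> carrier_vec p" "j < q" for y j
    using X that by (auto simp: scalar_prod_def)
  have of_real: "col ?X j \<bullet> map_vec complex_of_real y = complex_of_real (col X j \<bullet> y)"
    if "y \<in> carrier_vec p" "j < q" for y j
    using X that by (auto simp: scalar_prod_def)
  have "(\<forall>y\<in>carrier_vec p. ?X\<^sup>T *\<^sub>v y = 0\<^sub>v q \<longrightarrow> y = 0\<^sub>v p)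
      \<longleftrightarrow> (\<forall>y\<in>carrier_vec p. X\<^sup>T *\<^sub>v y = 0\<^sub>v q \<longrightarrow> y = 0\<^sub>v p)" (is "?L \<longleftrightarrow> ?R")
  proof
    assume L: ?L
    show ?R
    proof (intro ballI impI)
      fix y assume "y \<in> carrier_vec p" "X\<^sup>T *\<^sub>v y = 0\<^sub>v q"
      then have "map_vec complex_of_real y = 0\<^sub>v p"
        using L[rule_format, of "map_vec complex_of_real y"] of_real mult_transpose_zero_iff[OF X] mult_transpose_zero_iff[OF cX] by simp
      then show "y = 0\<^sub>v p" by (auto simp: vec_eq_iff)
    qed
  next
    assume R: ?R
    show ?L
    proof (intro ballI impI)
      fix y assume y: "y \<in> carrier_vec p" "?X\<^sup>T *\<^sub>v y = 0\<^sub>v q"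
      then have "col ?X j \<bullet> y = 0" if "j < q" for j
        using that mult_transpose_zero_iff[OF cX] by blast
      then have "map_vec Re y = 0\<^sub>v p" "map_vec Im y = 0\<^sub>v p"
        using R y(1) Re Im mult_transpose_zero_iff[OF X] by (metis map_carrier_vec zero_complex.sel)+
      then show "y = 0\<^sub>v p" using y(1) by (auto simp: vec_eq_iff complex_eq_iff)
    qed
  qed
  then show ?thesis using vec_space.rank_eq_dim_iff[OF X] vec_space.rank_eq_dim_iff[OF cX] by simp
qed

lemma map_mat_controllability_mat:
  assumes A: "A \<in> carrier_mat n n" and B: "B \<in> carrier_mat n m"
  shows "map_mat complex_of_real (controllability_mat A B)
    = controllability_mat (map_mat complex_of_real A) (map_mat complex_of_real B)"
proof -
  have entry: "complex_of_real ((A ^\<^sub>m k * B) $$ (i, j))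
      = (map_mat complex_of_real A ^\<^sub>m k * map_mat complex_of_real B) $$ (i, j)"
    if "i < n" "j < m" for i j k
  proof -
    have "map_mat complex_of_real (A ^\<^sub>m k * B)
        = map_mat complex_of_real A ^\<^sub>m k * map_mat complex_of_real B"
      by (simp add: of_real_hom.mat_hom_mult[OF pow_carrier_mat[OF A] B] of_real_hom.mat_hom_pow[OF A])
    then show ?thesis
      using that A B index_map_mat(1)[of i "A ^\<^sub>m k * B" j complex_of_real]
      by (simp del: index_mult_mat(1))
  qed
  show ?thesis
  proof (rule eq_matI)
    fix i j assume "i < dim_row (controllability_mat (map_mat complex_of_real A) (map_mat complex_of_real B))"
      "j < dim_col (controllability_mat (map_mat complex_of_real A) (map_mat complex_of_real B))"
    then have ij: "i < n" "j < n * m" using A B by (auto simp: controllability_mat_def)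
    then have "0 < m" by (cases m) auto
    then show "map_mat complex_of_real (controllability_mat A B) $$ (i, j)
        = controllability_mat (map_mat complex_of_real A) (map_mat complex_of_real B) $$ (i, j)"
      using ij A B entry[of i "j mod m" "j div m"] by (simp add: controllability_mat_def)
  qed (use A B in \<open>auto simp: controllability_mat_def\<close>)
qed

lemma rank_mult_eq_iff:
  fixes C :: "'a :: field mat"
  assumes C: "C \<in> carrier_mat p n" and X: "X \<in> carrier_mat n q"
  shows "vec_space.rank p (C * X) = p
    \<longleftrightarrow> (\<forall>y\<in>carrier_vec p. X\<^sup>T *\<^sub>v (C\<^sup>T *\<^sub>v y) = 0\<^sub>v q \<longrightarrow> y = 0\<^sub>v p)"
proof -
  have "(C * X)\<^sup>T *\<^sub>v y = X\<^sup>T *\<^sub>v (C\<^sup>T *\<^sub>v y)" if "y \<in> carrier_vec p" for y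
    using C X that assoc_mult_mat_vec[of "X\<^sup>T" q n "C\<^sup>T" p y] by (simp add: transpose_mult[OF C X])
  then show ?thesis using vec_space.rank_eq_dim_iff[OF mult_carrier_mat[OF C X]] by simp
qed

text \<open>A rank defect of the pencil yields an eigenvector of the transpose killed by
  \<open>B\<^sup>T\<close>. Conversely such a vector also makes \<open>l\<close> an eigenvalue of
  \<open>A\<close>, as \<open>A\<close> and its transpose share the characteristic
  polynomial.\<close>

lemma uncontrollable_eigenvalue_iff:
  fixes A :: "'a :: field mat"
  assumes A: "A \<in> carrier_mat n n" and B: "B \<in> carrier_mat n m"
  shows "uncontrollable_eigenvalue A B l \<longleftrightarrow> (\<exists>v. eigenvector A\<^sup>T v l \<and> B\<^sup>T *\<^sub>v v = 0\<^sub>v m)"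
proof -
  note P = pencil_mat_carrier[OF A B, of l]
  have "vec_space.rank n (pencil_mat A B l) < n \<longleftrightarrow> vec_space.rank n (pencil_mat A B l) \<noteq> n"
    using vec_space.rank_le_dim[OF P] by linarith
  also have "\<dots> \<longleftrightarrow> (\<exists>v. eigenvector A\<^sup>T v l \<and> B\<^sup>T *\<^sub>v v = 0\<^sub>v m)"
    using A transpose_pencil_mat_kernel[OF A B]
    unfolding vec_space.rank_eq_dim_iff[OF P] eigenvector_def by auto
  moreover have "eigenvalue A l" if "eigenvector A\<^sup>T v l" for v
    using that A eigenvalue_root_char_poly[OF A] eigenvalue_root_char_poly[of "A\<^sup>T" n]
    by (auto simp: eigenvalue_def)
  ultimately show ?thesis using A by (auto simp: uncontrollable_eigenvalue_def)
qed

section \<open>Equivalence of the two rank conditions\<close>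

theorem corollary4:
  fixes A B C :: "real mat" and n m p :: nat and lbar :: complex
  defines "cA \<equiv> map_mat complex_of_real A"
    and "cB \<equiv> map_mat complex_of_real B"
    and "cC \<equiv> map_mat complex_of_real C"
  assumes A: "A \<in> carrier_mat n n"
    and B: "B \<in> carrier_mat n m"
    and C: "C \<in> carrier_mat p n"
    and "p < n"
    and C_rank: "vec_space.rank p C = p"
    and N: "nontrivial_chain_span (transpose_mat cA) \<inter> mat_kernel (transpose_mat cB)
              \<subseteq> mat_image (transpose_mat cC)"
    and lbar: "{l. uncontrollable_eigenvalue cA cB l} = {lbar}"
  shows "output_controllable A B C \<longleftrightarrow>
         vec_space.rank p (cC * pencil_mat cA cB lbar) = p"
proof -
  have n: "0 < n" using \<open>p < n\<close> by simp
  have cA: "cA \<in> carrier_mat n n" and cB: "cB \<in> carrier_mat n m" and cC: "cC \<in> carrier_mat p n"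
    using A B C by (auto simp: cA_def cB_def cC_def)
  have M: "cA\<^sup>T \<in> carrier_mat n n" and K: "cB\<^sup>T \<in> carrier_mat m n"
    using cA cB by auto
  \<comment> \<open>The full row rank of \<open>C\<close>, carried over to the complex numbers; it
    turns a nonzero \<open>y\<close> into a nonzero vector of the image.\<close>
  have inj: "y = 0\<^sub>v p" if "y \<in> carrier_vec p" "cC\<^sup>T *\<^sub>v y = 0\<^sub>v n" for y
    using that C_rank rank_map_complex_of_real_eq_iff[OF C] vec_space.rank_eq_dim_iff[OF cC]
    by (simp add: cC_def)
  have carrier: "cC\<^sup>T *\<^sub>v y \<in> carrier_vec n" for y
    unfolding carrier_vec_def using cC by simp
  have "map_mat complex_of_real (C * controllability_mat A B) = cC * controllability_mat cA cB"
    by (simp add: of_real_hom.mat_hom_mult[OF C controllability_mat_carrier[OF A B]]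
        map_mat_controllability_mat[OF A B] cA_def cB_def cC_def)
  then have "output_controllable A B C \<longleftrightarrow> vec_space.rank p (cC * controllability_mat cA cB) = p"
    using rank_map_complex_of_real_eq_iff[OF mult_carrier_mat[OF C controllability_mat_carrier[OF A B]]] C
    by (simp add: output_controllable_def)
  also have "\<dots> \<longleftrightarrow> (\<forall>y\<in>carrier_vec p. cC\<^sup>T *\<^sub>v y \<in> unobservable_space cA\<^sup>T cB\<^sup>T \<longrightarrow> y = 0\<^sub>v p)"
    using rank_mult_eq_iff[OF cC controllability_mat_carrier[OF cA cB]]
      transpose_controllability_mat_kernel[OF cA cB carrier] by simp
  also have "\<dots> \<longleftrightarrow> (\<forall>y\<in>carrier_vec p. cA\<^sup>T *\<^sub>v (cC\<^sup>T *\<^sub>v y) = lbar \<cdot>\<^sub>v (cC\<^sup>T *\<^sub>v y)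
      \<and> cB\<^sup>T *\<^sub>v (cC\<^sup>T *\<^sub>v y) = 0\<^sub>v m \<longrightarrow> y = 0\<^sub>v p)" (is "?L \<longleftrightarrow> ?R")
  proof
    assume ?L
    then show ?R using eigenvector_in_unobservable_space[OF M K carrier] by blast
  next
    assume R: ?R
    show ?L
    proof (intro ballI impI, rule ccontr)
      fix y assume y: "y \<in> carrier_vec p" "cC\<^sup>T *\<^sub>v y \<in> unobservable_space cA\<^sup>T cB\<^sup>T" "y \<noteq> 0\<^sub>v p"
      have uniq: "\<forall>\<mu> v. eigenvector cA\<^sup>T v \<mu> \<and> cB\<^sup>T *\<^sub>v v = 0\<^sub>v m \<longrightarrow> \<mu> = lbar"
        using lbar uncontrollable_eigenvalue_iff[OF cA cB] by blast
      have nz: "cC\<^sup>T *\<^sub>v y \<noteq> 0\<^sub>v n" using inj y by blast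
      from M K n uniq y(2) nz show False
      proof (rule unobservable_space_chain)
        assume "cA\<^sup>T *\<^sub>v (cC\<^sup>T *\<^sub>v y) = lbar \<cdot>\<^sub>v (cC\<^sup>T *\<^sub>v y)"
        then show False using R y unobservable_space_kernel(2)[OF M K n y(2)] by blast
      next
        fix u v assume chain: "jordan_chain cA\<^sup>T lbar [v, u]" and v: "cB\<^sup>T *\<^sub>v v = 0\<^sub>v m"
        interpret vec_space "TYPE(complex)" n .
        define G where "G = {hd vs | vs l. jordan_chain cA\<^sup>T l vs \<and> 2 \<le> length vs}"
        have dim: "dim_row cA\<^sup>T = n" using M by simp
        have "G \<subseteq> carrier_vec n"
          using dim by (auto simp: G_def jordan_chain_def eigenvector_def)
        \<comment> \<open>The chain \<open>[v, u]\<close> has length two, so its head is one of the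
          generators.\<close>
        moreover have "v \<in> G" using chain by (force simp: G_def)
        ultimately have "v \<in> nontrivial_chain_span cA\<^sup>T"
          using in_own_span[of G] unfolding nontrivial_chain_span_def dim G_def[symmetric] by auto
        moreover have ev: "eigenvector cA\<^sup>T v lbar" using chain by (simp add: jordan_chain_def)
        ultimately obtain x where x: "x \<in> carrier_vec p" "v = cC\<^sup>T *\<^sub>v x"
          using N v cA K cC mat_kernelI[OF K, of v] by (auto simp: mat_image_def eigenvector_def)
        \<comment> \<open>The rank condition, in the form \<open>R\<close>, is applied to the
          preimage of the chain's eigenvector, not to the original \<open>y\<close>.\<close>
        then have "x = 0\<^sub>v p" using R ev v by (auto simp: eigenvector_def)
        then have "v = 0\<^sub>v n" using x(2) cC by auto
        then show False using ev dim by (simp add: eigenvector_def)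
      qed
    qed
  qed
  also have "\<dots> \<longleftrightarrow> vec_space.rank p (cC * pencil_mat cA cB lbar) = p"
    using rank_mult_eq_iff[OF cC pencil_mat_carrier[OF cA cB]]
      transpose_pencil_mat_kernel[OF cA cB carrier] by simp
  finally show ?thesis .
qed

end
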